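(* (i) Let $\Lambda$ be an AR language satisfying $(Rabc)$. Then the primitive words $v$ such that $vv$ is in $\Lambda$ are all the $A_p$ for $p\ge 0$, all the $B_p$ for $p\ge\lambda_1$, all the $C_p$ for $p\geq\lambda_2$, and some (possibly none) of the (cyclic) conjugates of these words. (ii) For a primitive word $v$ on $\{a,b,c\}$, the following assertions are equivalent: (1) $v$ is conjugate to a standard AR word; (2) $vv$ is an AR word; (3) $v'v'$ is an AR word for some conjugate $v'$ of $v$; (4) there is an AR language $\Lambda$ containing all the conjugates of $v$; (5) $v$ can be de-substituted down, using the six AR morphisms $\tau_x$ and $\sigma_x$, $x\in\{a,b,c\}$, to a single letter, i.e. $v=f(y)$ for some letter $y\in\{a,b,c\}$ and some finite (possibly empty) composition $f$ of these morphisms.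
   Context: The alphabet is $\{a,b,c\}$. A (nonempty) word is primitive if it is not a power of another word. The (cyclic) conjugates of $w_1\cdots w_n$ are the words $w_i\cdots w_nw_1\cdots w_{i-1}$, $1\le i\le n$. AR (Arnoux-Rauzy) languages. Given an infinite sequence of rules $(x_k)_{k\ge0}$, $x_k\in\{a,b,c\}$, in which each of $a,b,c$ occurs infinitely often, define words by $A_0=a$, $B_0=b$, $C_0=c$ and: by rule $(a)$ at stage $k$ (i.e. $x_k=a$), $A_{k+1}=A_k$, $B_{k+1}=B_kA_k$, $C_{k+1}=C_kA_k$; by rule $(b)$, $A_{k+1}=A_kB_k$, $B_{k+1}=B_k$, $C_{k+1}=C_kB_k$; by rule $(c)$, $A_{k+1}=A_kC_k$, $B_{k+1}=B_kC_k$, $C_{k+1}=C_k$. The AR language $\Lambda$ generated by these rules is the set of all factors of the words $A_k,B_k,C_k$, $k\ge0$. An AR word is a factor of (i.e. an element of) some AR language. A standard AR word is a word $A_k$, $B_k$ or $C_k$, $k\ge 0$, in some AR language. $(Rabc)$: the rule at stage $0$ is $(a)$ and the first rule different from $(a)$ is $(b)$. Under $(Rabc)$, $\lambda_1$ is the stage of the first rule $(b)$ and $\lambda_2$ is the stage of the first rule $(c)$. AR morphisms: for $x,y\in\{a,b,c\}$, $\sigma_x$ is the morphism (for concatenation) with $\sigma_x(x)=x$ and $\sigma_x(y)=yx$ for $y\ne x$; $\tau_x$ is the morphism with $\tau_x(x)=x$ and $\tau_x(y)=xy$ for $y\neq x$. *)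

theory Defs
  imports Main "HOL-Library.Infinite_Set" "HOL-Library.Sublist"
begin

datatype letter = La | Lb | Lc

type_synonym word = "letter list"

definition primitive_word :: "'a list \<Rightarrow> bool" where
  "primitive_word w \<longleftrightarrow> w \<noteq> [] \<and> \<not> (\<exists>u n. u \<noteq> w \<and> w = concat (replicate n u))"

definition conjugates :: "'a list \<Rightarrow> 'a list set" where
  "conjugates w = {rotate i w | i. i < length w}"

text \<open>
  A sequence of rules is encoded by the sequence of letters naming them.
  The words \<open>A\<^sub>k\<close>, \<open>B\<^sub>k\<close>, \<open>C\<^sub>k\<close> are \<open>std_word x La k\<close>, \<open>std_word x Lb k\<close>, \<open>std_word x Lc k\<close>:
  the rule \<open>x k\<close> keeps the word attached to the letter \<open>x k\<close> and appends it to the two others.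
\<close>

definition ar_rules :: "(nat \<Rightarrow> letter) \<Rightarrow> bool" where
  "ar_rules x \<longleftrightarrow> (\<forall>y. \<exists>\<^sub>\<infinity>k. x k = y)"

primrec std_word :: "(nat \<Rightarrow> letter) \<Rightarrow> letter \<Rightarrow> nat \<Rightarrow> word" where
  "std_word x y 0 = [y]"
| "std_word x y (Suc k) =
     (if y = x k then std_word x y k else std_word x y k @ std_word x (x k) k)"

definition language_of :: "(nat \<Rightarrow> letter) \<Rightarrow> word set" where
  "language_of x = {w. \<exists>k y. sublist w (std_word x y k)}"

definition ar_language :: "word set \<Rightarrow> bool" where
  "ar_language L \<longleftrightarrow> (\<exists>x. ar_rules x \<and> L = language_of x)"

definition ar_word :: "word \<Rightarrow> bool" where
  "ar_word w \<longleftrightarrow> (\<exists>L. ar_language L \<and> w \<in> L)"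

definition standard_ar_word :: "word \<Rightarrow> bool" where
  "standard_ar_word w \<longleftrightarrow> (\<exists>x y k. ar_rules x \<and> w = std_word x y k)"

text \<open>
  \<open>LEAST\<close> is only meaningful for sequences that contain the letter in question, as is the case
  when \<open>ar_rules x\<close> holds.
\<close>

definition first_stage :: "(nat \<Rightarrow> letter) \<Rightarrow> letter \<Rightarrow> nat" where
  "first_stage x y = (LEAST k. x k = y)"

definition Rabc :: "(nat \<Rightarrow> letter) \<Rightarrow> bool" where
  "Rabc x \<longleftrightarrow> x 0 = La \<and> x (LEAST k. x k \<noteq> La) = Lb"

definition sigma :: "letter \<Rightarrow> word \<Rightarrow> word" where
  "sigma x w = concat (map (\<lambda>y. if y = x then [x] else [y, x]) w)"

definition tau :: "letter \<Rightarrow> word \<Rightarrow> word" where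
  "tau x w = concat (map (\<lambda>y. if y = x then [x] else [x, y]) w)"

definition desubstitutes_to_letter :: "word \<Rightarrow> bool" where
  "desubstitutes_to_letter v \<longleftrightarrow>
     (\<exists>fs y. set fs \<subseteq> range sigma \<union> range tau \<and> v = foldr (\<circ>) fs id [y])"

end

theory Submission
  imports Defs
begin

text \<open>
  Everything rests on desubstitution. The words attached to a sequence of rules \<open>x\<close> are the images under
  \<open>\<sigma>\<^bsub>x 0\<^esub>\<close> of those attached to the shifted sequence (\<open>std_word_Suc_shift\<close>), so
  \<open>language_of x\<close> consists of the factors of \<open>\<sigma>\<^bsub>x 0\<^esub>\<close>-images of words of the shifted language.
  Writing \<open>r = x 0\<close>, a position after a letter \<open>r\<close> is always a boundary between blocks \<open>\<sigma>\<^sub>r(y)\<close>, so a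
  factor \<open>\<sigma>\<^sub>r(s)\<close> desubstitutes to a factor \<open>s\<close> if it can be preceded by \<open>r\<close>; and
  every factor can be prolonged by some letter on either side (\<open>extend_left\<close>, \<open>extend_right\<close>).

  The heart is \<open>conjugate_std_wordI\<close>: a primitive word all of whose conjugates lie in
  \<open>language_of x\<close> is conjugate to some \<open>std_word x y k\<close>. Up to conjugation, such a word longer than one
  letter is \<open>\<sigma>\<^sub>r(u)\<close> with \<open>u\<close> shorter and primitive; by induction on the length it is enough to know
  that all conjugates of \<open>u\<close> lie in the shifted language. The only conjugates that do not desubstitute at once
  begin and end with \<open>r\<close>; if the initial run has length \<open>i\<close>, a failure would give a maximal run of \<open>i - 1\<close> letters \<open>r\<close> as well as a run of
  at least \<open>i + 1\<close>, while no run exceeds a maximal run of the same letter by more than one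
  (\<open>run_length_bound\<close>).

  For the equivalences, a word conjugate to \<open>std_word x y k\<close> has its square inside a cube of
  \<open>std_word x y k\<close>, and that cube appears in the language where, from stage \<open>k\<close> on, the rule \<open>y\<close> is applied three
  times. A square \<open>v'v'\<close> contains all conjugates of \<open>v'\<close>, and the heart closes the
  circle. Assertion (5) is equivalent to (1) because \<open>\<tau>\<^sub>r(u)\<close> is conjugate to \<open>\<sigma>\<^sub>r(u)\<close>, and a
  conjugate of \<open>\<sigma>\<^sub>r(u)\<close> is \<open>\<sigma>\<^sub>r(u')\<close> or \<open>\<tau>\<^sub>r(u')\<close> with \<open>u'\<close> conjugate to \<open>u\<close>,
  according to whether the cut falls between two blocks or inside one.

  For a fixed language it remains to see which standard words have squares: \<open>std_word x y p\<close>
  does as soon as the rule \<open>y\<close> has occurred at a stage at most \<open>p\<close> (\<open>std_word_square\<close>), and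
  otherwise no conjugate does, since \<open>std_word x y p @ [y]\<close> would desubstitute to \<open>yy\<close> in a language
  whose initial rule is not \<open>y\<close> (\<open>std_word_snoc_notin\<close>).
\<close>

section \<open>Conjugacy and primitivity\<close>

lemma conjugates_rotate: "v \<in> conjugates u \<longleftrightarrow> u \<noteq> [] \<and> (\<exists>i. v = rotate i u)"
proof
  assume "u \<noteq> [] \<and> (\<exists>i. v = rotate i u)"
  then obtain i where "u \<noteq> []" "v = rotate (i mod length u) u"
    by (metis rotate_conv_mod)
  then show "v \<in> conjugates u"
    by (auto simp: conjugates_def)
qed (auto simp: conjugates_def)

lemma conjugates_split: "v \<in> conjugates u \<longleftrightarrow> u \<noteq> [] \<and> (\<exists>p q. u = p @ q \<and> v = q @ p)"
proof
  assume "v \<in> conjugates u"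
  then obtain i where "u \<noteq> []" "v = rotate i u"
    by (auto simp: conjugates_rotate)
  then show "u \<noteq> [] \<and> (\<exists>p q. u = p @ q \<and> v = q @ p)"
    by (metis rotate_drop_take append_take_drop_id)
next
  assume "u \<noteq> [] \<and> (\<exists>p q. u = p @ q \<and> v = q @ p)"
  then show "v \<in> conjugates u"
    by (metis conjugates_rotate rotate_append)
qed

lemma conjugates_refl: "u \<noteq> [] \<Longrightarrow> u \<in> conjugates u"
  by (auto simp: conjugates_split)

lemma conjugates_sym: "v \<in> conjugates u \<Longrightarrow> u \<in> conjugates v"
  by (auto simp: conjugates_split)

lemma conjugates_trans: "w \<in> conjugates v \<Longrightarrow> v \<in> conjugates u \<Longrightarrow> w \<in> conjugates u"
  by (auto simp: conjugates_rotate rotate_rotate)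

lemma conjugates_nonempty: "v \<in> conjugates u \<Longrightarrow> v \<noteq> [] \<and> u \<noteq> []"
  by (auto simp: conjugates_split)

lemma conjugate_in_square: "v' \<in> conjugates v \<Longrightarrow> sublist v' (v @ v)"
  unfolding conjugates_split sublist_def by (metis append.assoc)

lemma conjugate_square_in_cube: "v \<in> conjugates w \<Longrightarrow> sublist (v @ v) (w @ w @ w)"
  unfolding conjugates_split sublist_def by (metis append.assoc)

lemma primitive_word_exponent:
  "primitive_word w \<longleftrightarrow> w \<noteq> [] \<and> (\<forall>u n. w = concat (replicate n u) \<longrightarrow> n = 1)"
proof -
  have "u = w \<longleftrightarrow> n = 1" if "w \<noteq> []" "w = concat (replicate n u)" for u n
  proof -
    have "length w = n * length u"
      using that(2) by (simp add: length_concat sum_list_replicate)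
    then show ?thesis
      using that by auto
  qed
  then show ?thesis
    unfolding primitive_word_def by metis
qed

lemma rotate_concat_replicate:
  "rotate i (concat (replicate n u)) = concat (replicate n (rotate i u))"
proof (induction i)
  case (Suc i)
  have "rotate1 (concat (replicate n w)) = concat (replicate n (rotate1 w))" for w :: "'a list"
  proof (cases w)
    case (Cons a t)
    have "concat (replicate m (a # t)) @ [a] = a # concat (replicate m (t @ [a]))" for m
      by (induction m) auto
    then show ?thesis
      using Cons by (cases n) auto
  qed auto
  then show ?case
    using Suc by simp
qed simp

lemma primitive_conjugate:
  assumes "primitive_word v" "v' \<in> conjugates v"
  shows "primitive_word v'"
proof -
  obtain i where i: "v = rotate i v'"
    using conjugates_sym[OF assms(2)] by (auto simp: conjugates_rotate)
  show ?thesis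
    unfolding primitive_word_exponent
  proof (intro conjI allI impI)
    show "v' \<noteq> []"
      using assms(2) conjugates_nonempty by blast
    fix u n assume "v' = concat (replicate n u)"
    then have "v = concat (replicate n (rotate i u))"
      using i rotate_concat_replicate by metis
    then show "n = 1"
      using assms(1) primitive_word_exponent by blast
  qed
qed

section \<open>The morphisms\<close>

lemma sigma_Nil [simp]: "sigma r [] = []"
  and sigma_Cons [simp]: "sigma r (y # w) = (if y = r then [r] else [y, r]) @ sigma r w"
  and sigma_append [simp]: "sigma r (w @ w') = sigma r w @ sigma r w'"
  by (simp_all add: sigma_def)

lemma tau_Nil [simp]: "tau r [] = []"
  and tau_Cons [simp]: "tau r (y # w) = (if y = r then [r] else [r, y]) @ tau r w"
  and tau_append [simp]: "tau r (w @ w') = tau r w @ tau r w'"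
  by (simp_all add: tau_def)

lemma sigma_replicate [simp]: "sigma r (replicate n r) = replicate n r"
  by (induction n) auto

lemma sigma_concat_replicate: "sigma r (concat (replicate n w)) = concat (replicate n (sigma r w))"
  by (induction n) auto

lemma sigma_eq_Nil [simp]: "sigma r w = [] \<longleftrightarrow> w = []"
  by (cases w) auto

lemma last_sigma: "w \<noteq> [] \<Longrightarrow> last (sigma r w) = r"
  by (induction w) auto

lemma sigma_inject [simp]: "sigma r u = sigma r w \<longleftrightarrow> u = w"
proof (induction u arbitrary: w)
  case (Cons y u)
  then show ?case
    by (cases w) (auto split: if_splits)
qed (auto dest: sym)

lemma length_sigma_less:
  assumes "z \<in> set u" "z \<noteq> r"
  shows "length u < length (sigma r u)"
proof -
  have le: "length w \<le> length (sigma r w)" for w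
    by (induction w) auto
  show ?thesis
    using assms le by (induction u) (auto simp: less_Suc_eq_le le_SucI)
qed

lemma sigma_tau: "r # sigma r w = tau r w @ [r]"
  by (induction w) auto

lemma sublist_sigma: "sublist u w \<Longrightarrow> sublist (sigma r u) (sigma r w)"
  unfolding sublist_def by (metis sigma_append)

text \<open>Each block of \<open>sigma r\<close> ends with its unique \<open>r\<close>, so every \<open>r\<close> ends a block.\<close>

lemma sigma_cut:
  assumes "sigma r w = p @ r # q"
  obtains w1 w2 where "w = w1 @ w2" "sigma r w1 = p @ [r]" "sigma r w2 = q"
  using assms
proof (induction w arbitrary: p thesis)
  case (Cons y w)
  show ?case
  proof (cases "\<exists>b p'. p = b @ p' \<and> b = sigma r [y]")
    case True
    then obtain p' where p': "p = sigma r [y] @ p'" by blast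
    then have "sigma r w = p' @ r # q"
      using Cons.prems(2) by (auto split: if_splits)
    then obtain w1 w2 where "w = w1 @ w2" "sigma r w1 = p' @ [r]" "sigma r w2 = q"
      using Cons.IH by blast
    then show ?thesis
      using p' Cons.prems(1)[of "y # w1" w2] by auto
  next
    case False
    then have "p @ [r] = sigma r [y] \<and> sigma r w = q"
      using Cons.prems(2) by (cases p; cases "tl p") (auto split: if_splits)
    then show ?thesis
      using Cons.prems(1)[of "[y]" w] by auto
  qed
qed simp

lemma sigma_cut_inside:
  assumes "sigma r w = p @ z # q" "z \<noteq> r"
  obtains s t where "w = s @ z # t" "sigma r s = p" "q = r # sigma r t"
  using assms(1)
proof (induction w arbitrary: p thesis)
  case (Cons y w)
  show ?case
  proof (cases "p = []")
    case True
    then show ?thesis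
      using Cons.prems(1)[of "[]" w] Cons.prems(2) assms(2) by (auto split: if_splits)
  next
    case False
    then obtain p' where p': "p = sigma r [y] @ p'"
      using Cons.prems(2) assms(2) by (cases p; cases "tl p") (auto split: if_splits)
    then have "sigma r w = p' @ z # q"
      using Cons.prems(2) by (auto split: if_splits)
    then obtain s t where "w = s @ z # t" "sigma r s = p'" "q = r # sigma r t"
      using Cons.IH by blast
    then show ?thesis
      using p' Cons.prems(1)[of "y # s" t] by auto
  qed
qed simp

lemma primitive_sigma_iff: "primitive_word (sigma r u) \<longleftrightarrow> primitive_word u"
proof
  assume prim: "primitive_word (sigma r u)"
  then show "primitive_word u"
    unfolding primitive_word_exponent by (metis sigma_concat_replicate sigma_Nil)
next
  assume prim: "primitive_word u"
  have "n = 1" if eq: "sigma r u = concat (replicate n t)" for t n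
  proof -
    have "sigma r u \<noteq> []"
      using prim by (simp add: primitive_word_def)
    then obtain m where n: "n = Suc m" and t: "t \<noteq> []"
      using eq by (cases n; cases "t = []") auto
    have "concat (replicate (Suc m) t) = concat (replicate m t) @ t"
      by (induction m) auto
    then have "last t = r"
      using eq n t last_sigma[of u r] prim by (metis last_appendR primitive_word_def)
    then obtain t' where t': "t = t' @ [r]"
      using t by (metis append_butlast_last_id)
    \<comment> \<open>The root ends with \<open>r\<close>, hence consists of whole blocks.\<close>
    then have "sigma r u = t' @ r # concat (replicate m t)"
      using eq n by simp
    then obtain s where "sigma r s = t"
      using t' by (metis sigma_cut)
    then have "u = concat (replicate n s)"
      using eq by (metis sigma_concat_replicate sigma_inject)
    then show ?thesis
      using prim primitive_word_exponent by blast
  qed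
  then show "primitive_word (sigma r u)"
    using prim unfolding primitive_word_exponent by auto
qed

lemma sigma_conjugates: "u' \<in> conjugates u \<Longrightarrow> sigma r u' \<in> conjugates (sigma r u)"
  unfolding conjugates_split by (metis sigma_append sigma_eq_Nil)

lemma tau_conjugate_sigma:
  assumes "u \<noteq> []"
  shows "tau r u \<in> conjugates (sigma r u)"
proof -
  obtain t where t: "tau r u = r # t"
    using assms by (cases u; cases "hd u = r") auto
  then have "sigma r u = t @ [r]"
    using sigma_tau[of r u] by simp
  then show ?thesis
    unfolding t conjugates_split by (intro conjI exI[of _ t] exI[of _ "[r]"]) auto
qed

text \<open>A cut between two blocks leaves blocks of \<open>sigma r\<close>; a cut inside a block leaves blocks of \<open>tau r\<close>.\<close>

lemma conjugate_of_sigma: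
  assumes "v \<in> conjugates (sigma r u)"
  shows "\<exists>u' \<in> conjugates u. v = sigma r u' \<or> v = tau r u'"
proof -
  obtain p q where pq: "sigma r u = p @ q" "v = q @ p" and u: "u \<noteq> []"
    using assms by (auto simp: conjugates_split)
  consider "p = []" | p' where "p = p' @ [r]" | p' z where "p = p' @ [z]" "z \<noteq> r"
    by (metis rev_exhaust)
  then show ?thesis
  proof cases
    case 1
    then show ?thesis
      using pq u conjugates_refl by auto
  next
    case 2
    then obtain u1 u2 where "u = u1 @ u2" "sigma r u1 = p" "sigma r u2 = q"
      using pq(1) by (auto elim: sigma_cut)
    then show ?thesis
      using pq(2) u by (intro bexI[of _ "u2 @ u1"]) (auto simp: conjugates_split)
  next
    case 3
    then obtain s t where st: "u = s @ z # t" "sigma r s = p'" "q = r # sigma r t"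
      using pq(1) sigma_cut_inside[of r u p' z q] by auto
    have "v = tau r (t @ s @ [z])"
      using st 3 pq(2) sigma_tau[of r "t @ s"] by simp
    moreover have "t @ s @ [z] \<in> conjugates u"
      unfolding conjugates_split using st(1) by (intro conjI exI[of _ "s @ [z]"] exI[of _ t]) auto
    ultimately show ?thesis by blast
  qed
qed

section \<open>Factors of Arnoux-Rauzy languages\<close>

definition shift :: "(nat \<Rightarrow> letter) \<Rightarrow> nat \<Rightarrow> letter" where
  "shift x k = x (Suc k)"

lemma ar_rules_shift: "ar_rules x \<Longrightarrow> ar_rules (shift x)"
  unfolding ar_rules_def shift_def INFM_nat_le by (metis Suc_le_D Suc_le_mono)

lemma ar_rules_later: "ar_rules x \<Longrightarrow> \<exists>j\<ge>k. x j = y"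
  unfolding ar_rules_def INFM_nat_le by blast

lemma ar_rulesI: "(\<And>y k. \<exists>j\<ge>k. x j = y) \<Longrightarrow> ar_rules x"
  unfolding ar_rules_def INFM_nat_le by blast

lemma std_word_Suc_shift: "std_word x y (Suc k) = sigma (x 0) (std_word (shift x) y k)"
  by (induction k arbitrary: y) (auto simp: shift_def)

lemma std_word_Cons: "\<exists>W. std_word x y k = y # W"
  by (induction k) auto

lemma std_word_nonempty [simp]: "std_word x y k \<noteq> []"
  using std_word_Cons[of x y k] by auto

lemma std_word_cong: "(\<And>j. j < k \<Longrightarrow> x j = x' j) \<Longrightarrow> std_word x y k = std_word x' y k"
  by (induction k arbitrary: y) auto

lemma std_word_prefix: "k \<le> j \<Longrightarrow> prefix (std_word x y k) (std_word x y j)"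
proof (induction j rule: dec_induct)
  case (step j)
  then show ?case
    by (auto intro: prefix_order.order_trans)
qed simp

lemma primitive_std_word: "primitive_word (std_word x y k)"
proof (induction k arbitrary: x)
  case 0
  have "n = 1" if "[y] = concat (replicate n u)" for n u
  proof -
    have "1 = n * length u"
      using arg_cong[OF that, of length] by (simp add: length_concat sum_list_replicate)
    then show ?thesis by simp
  qed
  then show ?case
    by (simp add: primitive_word_exponent)
next
  case (Suc k)
  then show ?case
    by (simp only: std_word_Suc_shift primitive_sigma_iff)
qed

lemma std_word_in_language: "std_word x y k \<in> language_of x"
  unfolding language_of_def by blast

lemma language_sublist: "w \<in> language_of x \<Longrightarrow> sublist u w \<Longrightarrow> u \<in> language_of x"
  unfolding language_of_def by (auto intro: sublist_order.order_trans)

lemma language_sigma: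
  assumes "w \<in> language_of (shift x)"
  shows "sigma (x 0) w \<in> language_of x"
proof -
  obtain k y where "sublist w (std_word (shift x) y k)"
    using assms by (auto simp: language_of_def)
  then have "sublist (sigma (x 0) w) (std_word x y (Suc k))"
    unfolding std_word_Suc_shift by (rule sublist_sigma)
  then show ?thesis
    unfolding language_of_def by blast
qed

lemma language_cases:
  assumes "w \<in> language_of x"
  obtains y where "sublist w [y]" | w' where "w' \<in> language_of (shift x)" "sublist w (sigma (x 0) w')"
proof -
  obtain k y where ky: "sublist w (std_word x y k)"
    using assms by (auto simp: language_of_def)
  show ?thesis
  proof (cases k)
    case 0
    then show ?thesis using ky that(1) by simp
  next
    case (Suc m)
    then show ?thesis
      using ky that(2) std_word_in_language by (metis std_word_Suc_shift)
  qed
qed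

text \<open>The word attached to \<open>y\<close> is appended to another one as soon as the rule \<open>y\<close> comes back.\<close>

lemma extend_left:
  assumes "ar_rules x" "w \<in> language_of x"
  obtains z where "z # w \<in> language_of x"
proof -
  obtain k y where ky: "sublist w (std_word x y k)"
    using assms(2) by (auto simp: language_of_def)
  obtain j where j: "j \<ge> k" "x j = y"
    using ar_rules_later[OF assms(1)] by blast
  obtain u where u: "u \<noteq> y"
    by (metis letter.distinct(1))
  obtain p q where pq: "std_word x y j = p @ w @ q"
    using ky std_word_prefix[OF j(1)] by (metis prefix_imp_sublist sublist_def sublist_order.order_trans)
  obtain s z where sz: "std_word x u j @ p = s @ [z]"
    by (metis append_is_Nil_conv rev_exhaust std_word_nonempty)
  have "std_word x u (Suc j) = (std_word x u j @ p) @ w @ q"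
    using u j pq by simp
  also have "\<dots> = s @ (z # w) @ q"
    unfolding sz by simp
  finally show ?thesis
    using that std_word_in_language language_sublist by (metis sublist_appendI)
qed

lemma extend_right:
  assumes "ar_rules x" "w \<in> language_of x"
  obtains z where "w @ [z] \<in> language_of x"
proof -
  obtain k y where ky: "sublist w (std_word x y k)"
    using assms(2) by (auto simp: language_of_def)
  obtain u where u: "u \<noteq> y"
    by (metis letter.distinct(1))
  obtain j where j: "j \<ge> k" "x j = u"
    using ar_rules_later[OF assms(1)] by blast
  obtain p q where pq: "std_word x y j = p @ w @ q"
    using ky std_word_prefix[OF j(1)] by (metis prefix_imp_sublist sublist_def sublist_order.order_trans)
  obtain s z where sz: "q @ std_word x u j = z # s"
    by (metis append_is_Nil_conv neq_Nil_conv std_word_nonempty)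
  have "std_word x y (Suc j) = p @ w @ (q @ std_word x u j)"
    using u j pq by simp
  also have "\<dots> = p @ (w @ [z]) @ s"
    unfolding sz by simp
  finally show ?thesis
    using that std_word_in_language language_sublist by (metis sublist_appendI)
qed

lemma adjacent_letters:
  assumes "[z, z'] \<in> language_of x"
  shows "z = x 0 \<or> z' = x 0"
  using assms
proof (cases rule: language_cases)
  case (1 y)
  then show ?thesis
    by (auto dest: sublist_length_le)
next
  case (2 w')
  then obtain p q where pq: "sigma (x 0) w' = p @ z # z' # q"
    by (auto simp: sublist_def)
  then show ?thesis
    by (metis sigma_cut_inside list.inject)
qed

text \<open>Preceded by \<open>x 0\<close> and ending with \<open>x 0\<close>, a factor is cut out exactly along block boundaries.\<close>

lemma desubstitute:
  assumes "x 0 # t \<in> language_of x" "t = [] \<or> last t = x 0"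
  obtains s where "t = sigma (x 0) s" "s \<in> language_of (shift x)"
proof (cases "t = []")
  case True
  then show ?thesis
    using that[of "[]"] std_word_in_language language_sublist sublist_Nil_left
    by (metis sigma_Nil)
next
  case False
  then obtain t' where t': "t = t' @ [x 0]"
    using assms(2) by (metis append_butlast_last_id)
  show ?thesis
    using assms(1)
  proof (cases rule: language_cases)
    case (1 y)
    then show ?thesis
      using False by (auto dest: sublist_length_le)
  next
    case (2 w')
    then obtain p q where "sigma (x 0) w' = p @ x 0 # t @ q"
      by (auto simp: sublist_def)
    then obtain w1 w2 where w: "w' = w1 @ w2" "sigma (x 0) w2 = t' @ x 0 # q"
      using t' by (auto elim: sigma_cut)
    then obtain w3 w4 where "w2 = w3 @ w4" "sigma (x 0) w3 = t"
      using t' by (auto elim: sigma_cut)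
    then show ?thesis
      using that[of w3] 2(1) w(1) language_sublist by (metis sublist_appendI)
  qed
qed

lemma desubstitute_sigma:
  assumes "x 0 # sigma (x 0) s \<in> language_of x"
  shows "s \<in> language_of (shift x)"
proof -
  have "sigma (x 0) s = [] \<or> last (sigma (x 0) s) = x 0"
    using last_sigma by auto
  then obtain s' where "sigma (x 0) s = sigma (x 0) s'" "s' \<in> language_of (shift x)"
    by (rule desubstitute[OF assms])
  then show ?thesis by simp
qed

lemma desubstitute_hd:
  assumes "ar_rules x" "sigma (x 0) (z # s) \<in> language_of x" "z \<noteq> x 0"
  shows "z # s \<in> language_of (shift x)"
proof -
  obtain e where e: "e # sigma (x 0) (z # s) \<in> language_of x"
    using extend_left[OF assms(1,2)] .
  have "sublist [e, z] (e # sigma (x 0) (z # s))"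
    unfolding sublist_def using assms(3) by (intro exI[of _ "[]"] exI[of _ "x 0 # sigma (x 0) s"]) auto
  then have "e = x 0"
    using adjacent_letters[of e z x] language_sublist[OF e] assms(3) by blast
  then show ?thesis
    using e desubstitute_sigma[of x] by blast
qed

lemma replicate_in_language:
  assumes "replicate n a \<in> language_of x" "x 0 \<noteq> a"
  shows "n \<le> 1"
proof (rule ccontr)
  assume "\<not> n \<le> 1"
  then obtain m where n: "n = Suc (Suc m)"
    by (cases n; cases "n - 1") auto
  have "sublist [a, a] (replicate n a)"
    unfolding n using sublist_append_rightI[of "[a, a]" "replicate m a"] by simp
  then have "[a, a] \<in> language_of x"
    using assms(1) language_sublist by blast
  then show False
    using adjacent_letters[of a a x] assms(2) by blast
qed

text \<open>
  A run is maximal when it lies between two other letters. Desubstituting by the rule \<open>a\<close> shortens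
  every run of \<open>a\<close> by one, and a language whose initial rule is not \<open>a\<close> does not contain \<open>aa\<close>.
\<close>

lemma run_length_bound:
  assumes "ar_rules x" "z # replicate i a @ [z'] \<in> language_of x" "z \<noteq> a" "z' \<noteq> a"
    and "replicate n a \<in> language_of x"
  shows "n \<le> Suc i"
  using assms
proof (induction i arbitrary: x n)
  case 0
  then have "x 0 \<noteq> a"
    using adjacent_letters[of z z' x] by auto
  then show ?case
    using replicate_in_language "0.prems"(5) by simp
next
  case (Suc i)
  show ?case
  proof (cases "x 0 = a \<and> n > 0")
    case True
    then obtain m where n: "n = Suc m"
      by (metis gr0_implies_Suc)
    have "x 0 # sigma (x 0) (replicate m a) \<in> language_of x"
      using True Suc.prems(5) n by simp
    then have m: "replicate m a \<in> language_of (shift x)"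
      by (rule desubstitute_sigma)
    obtain e where e: "(z # replicate (Suc i) a @ [z']) @ [e] \<in> language_of x"
      using extend_right[OF Suc.prems(1,2)] .
    have "sublist [z', e] ((z # replicate (Suc i) a @ [z']) @ [e])"
      unfolding sublist_def by (intro exI[of _ "z # replicate (Suc i) a"] exI[of _ "[]"]) auto
    then have "e = a"
      using adjacent_letters[of z' e x] language_sublist[OF e] Suc.prems(4) True by auto
    then have "sigma (x 0) (z # replicate i a @ [z']) \<in> language_of x"
      using e True Suc.prems(3,4) by auto
    then have "z # replicate i a @ [z'] \<in> language_of (shift x)"
      using desubstitute_hd[OF Suc.prems(1)] Suc.prems(3) True by blast
    then have "m \<le> Suc i"
      using Suc.IH[OF ar_rules_shift[OF Suc.prems(1)]] Suc.prems(3,4) m by blast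
    then show ?thesis
      using n by simp
  next
    case False
    then have "n \<le> 1"
      using replicate_in_language[OF Suc.prems(5)] False by (cases "n = 0") auto
    then show ?thesis by simp
  qed
qed

section \<open>Words whose conjugates all lie in one language\<close>

text \<open>
  With \<open>r = x 0\<close>, both \<open>sigma r u'\<close> and \<open>tau r u'\<close> are at hand for every conjugate \<open>u'\<close> of \<open>u\<close>;
  the first yields \<open>u'\<close> if it can be prolonged by \<open>r\<close> on the left, the second if it can be prolonged by
  \<open>r\<close> on the right.
\<close>

lemma conjugates_desubstitute:
  assumes x: "ar_rules x" and sub: "conjugates (sigma (x 0) u) \<subseteq> language_of x"
    and c: "c \<in> set u" "c \<noteq> x 0"
  shows "conjugates u \<subseteq> language_of (shift x)"
proof
  fix u' assume u': "u' \<in> conjugates u"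
  let ?r = "x 0"
  have u'_ne: "u' \<noteq> []"
    using u' conjugates_nonempty by blast
  have conj: "sigma ?r w \<in> language_of x" if "w \<in> conjugates u" for w
    using sub sigma_conjugates[OF that] by blast
  show "u' \<in> language_of (shift x)"
  proof (rule ccontr)
    assume contra: "u' \<notin> language_of (shift x)"
    obtain e where e: "e # sigma ?r u' \<in> language_of x"
      using extend_left[OF x conj[OF u']] .
    have e_ne: "e \<noteq> ?r"
      using e contra desubstitute_sigma[of x u'] by blast
    have "tau ?r u' \<in> language_of x"
      using sub tau_conjugate_sigma[OF u'_ne] sigma_conjugates[OF u'] conjugates_trans by blast
    then obtain e' where e': "tau ?r u' @ [e'] \<in> language_of x"
      using extend_right[OF x] by blast
    have e'_ne: "e' \<noteq> ?r"
      using e' contra desubstitute_sigma[of x u'] sigma_tau[of ?r u'] by auto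
    have last: "last u' = ?r"
    proof (rule ccontr)
      assume ne: "last u' \<noteq> ?r"
      obtain s where s: "u' = s @ [last u']"
        using u'_ne by (metis append_butlast_last_id)
      then have "tau ?r u' = tau ?r s @ [?r, last u']"
        using ne tau_append[of ?r s "[last u']"] by simp
      then have "sublist [last u', e'] (tau ?r u' @ [e'])"
        unfolding sublist_def by (intro exI[of _ "tau ?r s @ [?r]"] exI[of _ "[]"]) auto
      then show False
        using adjacent_letters[of "last u'" e' x] language_sublist[OF e'] ne e'_ne by blast
    qed
    have "c \<in> set u'"
      using u' c(1) by (auto simp: conjugates_rotate)
    then have "\<exists>z\<in>set u'. z \<noteq> ?r"
      using c(2) by blast
    then obtain p z s where split: "u' = p @ z # s" "z \<noteq> ?r" "\<forall>y\<in>set p. y = ?r"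
      using split_list_first_prop[of u' "\<lambda>z. z \<noteq> ?r"] by blast
    obtain i where p: "p = replicate i ?r"
      using split(3) by (metis replicate_length_same)
    have i_pos: "i \<noteq> 0"
    proof
      assume "i = 0"
      then have "u' = z # s"
        using split(1) p by simp
      then show False
        using contra desubstitute_hd[OF x, of z s] conj[OF u'] split(2) by blast
    qed
    then obtain i' where i': "i = Suc i'"
      using not0_implies_Suc by blast
    have "sigma ?r (e # replicate i' ?r @ z # s) \<in> language_of x"
      using e e_ne split(1) p i' by simp
    then have "e # replicate i' ?r @ z # s \<in> language_of (shift x)"
      using desubstitute_hd[OF x, of e] e_ne by blast
    then have maximal_run: "e # replicate i' ?r @ [z] \<in> language_of (shift x)"
      using language_sublist sublist_append_rightI[of "e # replicate i' ?r @ [z]" s] by simp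
    \<comment> \<open>Rotating the initial run to the end joins it to the final letter \<open>r\<close>.\<close>
    have "z # s @ p \<in> conjugates u'"
      unfolding conjugates_split using split(1) by (intro conjI exI[of _ p] exI[of _ "z # s"]) auto
    then have rot: "z # s @ p \<in> language_of (shift x)"
      using desubstitute_hd[OF x, of z "s @ p"] conj[OF conjugates_trans[OF _ u']] split(2) by blast
    obtain s' where "s = s' @ [?r]"
      using last split by (cases s rule: rev_cases) auto
    then have "sublist (replicate (Suc i) ?r) (z # s @ p)"
      using p sublist_append_leftI[of "replicate (Suc i) ?r" "z # s'"] by simp
    then have "replicate (Suc i) ?r \<in> language_of (shift x)"
      using rot language_sublist by blast
    then have "Suc i \<le> Suc i'"
      using run_length_bound[OF ar_rules_shift[OF x] maximal_run] e_ne split(2) by blast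
    then show False
      using i' by simp
  qed
qed

theorem conjugate_std_wordI:
  assumes "ar_rules x" "primitive_word v" "conjugates v \<subseteq> language_of x"
  shows "\<exists>y k. v \<in> conjugates (std_word x y k)"
  using assms
proof (induction "length v" arbitrary: v x rule: less_induct)
  case less
  let ?r = "x 0"
  have v_ne: "v \<noteq> []"
    using less.prems(2) by (simp add: primitive_word_def)
  show ?case
  proof (cases "\<exists>c\<in>set v. c \<noteq> ?r")
    case False
    then have "v = replicate (length v) ?r"
      by (metis replicate_length_same)
    then have v: "v = concat (replicate (length v) [?r])"
      by (metis concat_map_singleton map_replicate map_ident)
    then have "length v = 1"
      using less.prems(2) unfolding primitive_word_exponent by blast
    then have "v = std_word x ?r 0"
      using v by simp
    then show ?thesis
      using conjugates_refl v_ne by metis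
  next
    case True
    then obtain p z q where split: "v = p @ z # q" "z \<noteq> ?r"
      by (metis split_list)
    define v1 where "v1 = z # q @ p"
    have v1: "v1 \<in> conjugates v"
      unfolding v1_def conjugates_split using split(1) by (intro conjI exI[of _ p] exI[of _ "z # q"]) auto
    then have v1_in: "v1 \<in> language_of x"
      using less.prems(3) by blast
    show ?thesis
    proof (cases "q @ p = []")
      case True
      then have "v = std_word x z 0"
        using split(1) by simp
      then show ?thesis
        using conjugates_refl v_ne by metis
    next
      case False
      then obtain t l where tl: "q @ p = t @ [l]"
        by (metis rev_exhaust)
      have "l # z # t \<in> conjugates v1"
        unfolding v1_def tl conjugates_split by (intro conjI exI[of _ "z # t"] exI[of _ "[l]"]) auto
      then have "l # z # t \<in> language_of x"
        using v1 less.prems(3) conjugates_trans by blast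
      then have "[l, z] \<in> language_of x"
        using language_sublist sublist_append_rightI[of "[l, z]" t] by simp
      then have l: "l = ?r"
        using adjacent_letters[of l z x] split(2) by blast
      obtain e where e: "e # v1 \<in> language_of x"
        using extend_left[OF less.prems(1) v1_in] .
      then have "[e, z] \<in> language_of x"
        using language_sublist sublist_append_rightI[of "[e, z]" "q @ p"] by (simp add: v1_def)
      then have "e = ?r"
        using adjacent_letters[of e z x] split(2) by blast
      then obtain u where u: "v1 = sigma ?r u"
        using desubstitute[of x v1] e l tl by (auto simp: v1_def)
      have z: "z \<in> set u"
        using u split(2) unfolding v1_def by (cases u) (auto split: if_splits)
      have "length v1 = length v"
        using split(1) by (simp add: v1_def)
      then have "length u < length v"
        using length_sigma_less[OF z split(2)] u by simp
      moreover have "primitive_word u"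
        using primitive_conjugate[OF less.prems(2) v1] u primitive_sigma_iff by metis
      moreover have "conjugates (sigma ?r u) \<subseteq> language_of x"
        using less.prems(3) v1 u conjugates_trans by blast
      then have "conjugates u \<subseteq> language_of (shift x)"
        using conjugates_desubstitute[OF less.prems(1)] z split(2) by blast
      ultimately obtain y k where "u \<in> conjugates (std_word (shift x) y k)"
        using less.hyps ar_rules_shift[OF less.prems(1)] by blast
      then have "v1 \<in> conjugates (std_word x y (Suc k))"
        unfolding u std_word_Suc_shift by (rule sigma_conjugates)
      then show ?thesis
        using conjugates_sym[OF v1] conjugates_trans by blast
    qed
  qed
qed

section \<open>Squares of standard words\<close>

text \<open>
  The overlap is inherited through each rule \<open>r\<close> other than \<open>y\<close>: the word \<open>yW\<close> becomes
  \<open>yr\<sigma>\<^sub>r(W)\<close>, and the image of any letter placed before \<open>WyW\<close> supplies the \<open>r\<close> missing in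
  front of \<open>\<sigma>\<^sub>r(W)yr\<sigma>\<^sub>r(W)\<close>.
\<close>

lemma std_word_overlap:
  assumes "ar_rules x" "\<forall>j<k. x j \<noteq> y"
  shows "\<exists>W. std_word x y k = y # W \<and> W @ y # W \<in> language_of x"
  using assms
proof (induction k arbitrary: x)
  case 0
  then show ?case
    using std_word_in_language[of x y 0] by simp
next
  case (Suc k)
  let ?r = "x 0"
  have "\<forall>j<k. shift x j \<noteq> y"
    using Suc.prems(2) by (auto simp: shift_def)
  then obtain W where W: "std_word (shift x) y k = y # W" "W @ y # W \<in> language_of (shift x)"
    using Suc.IH[OF ar_rules_shift] Suc.prems(1) by blast
  obtain e where "e # W @ y # W \<in> language_of (shift x)"
    using extend_left[OF ar_rules_shift W(2)] Suc.prems(1) by blast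
  then have "sigma ?r (e # W @ y # W) \<in> language_of x"
    by (rule language_sigma)
  moreover have ne: "y \<noteq> ?r"
    using Suc.prems(2) by auto
  have "sublist ((?r # sigma ?r W) @ y # ?r # sigma ?r W) (sigma ?r (e # W @ y # W))"
    unfolding sublist_def using ne
    by (intro exI[of _ "if e = ?r then [] else [e]"] exI[of _ "[]"]) auto
  ultimately have "(?r # sigma ?r W) @ y # ?r # sigma ?r W \<in> language_of x"
    by (rule language_sublist)
  moreover have "std_word x y (Suc k) = y # ?r # sigma ?r W"
    unfolding std_word_Suc_shift W(1) using ne by simp
  ultimately show ?case by blast
qed

text \<open>
  Desubstituting down to the last stage at most \<open>p\<close> with the rule \<open>y\<close> leaves an overlap \<open>WyW\<close>
  made by the later rules; the rule \<open>y\<close> itself then puts a \<open>y\<close> in front of it and closes the square.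
\<close>

lemma std_word_square:
  assumes "ar_rules x" "q \<le> p" "x q = y"
  shows "std_word x y p @ std_word x y p \<in> language_of x"
  using assms
proof (induction p arbitrary: x q)
  case 0
  obtain e where "e # [y] \<in> language_of (shift x)"
    using extend_left[OF ar_rules_shift[OF "0.prems"(1)]] std_word_in_language[of "shift x" y 0] by auto
  then have "sigma (x 0) (e # [y]) \<in> language_of x"
    by (rule language_sigma)
  then show ?case
    using 0 language_sublist[of _ x "[y, y]"] sublist_append_leftI[of "[y, y]" "[e]"]
    by (cases "e = y") auto
next
  case (Suc p)
  show ?case
  proof (cases "\<exists>q'\<le>p. shift x q' = y")
    case True
    then have "std_word (shift x) y p @ std_word (shift x) y p \<in> language_of (shift x)"
      using Suc.IH[OF ar_rules_shift] Suc.prems(1) by blast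
    then show ?thesis
      unfolding std_word_Suc_shift sigma_append[symmetric] by (rule language_sigma)
  next
    case False
    then have y: "x 0 = y"
      using Suc.prems(2,3) by (cases q) (auto simp: shift_def)
    have "\<forall>j<p. shift x j \<noteq> y"
      using False by auto
    then obtain W where W: "std_word (shift x) y p = y # W" "W @ y # W \<in> language_of (shift x)"
      using std_word_overlap[OF ar_rules_shift] Suc.prems(1) by blast
    obtain e where "e # W @ y # W \<in> language_of (shift x)"
      using extend_left[OF ar_rules_shift W(2)] Suc.prems(1) by blast
    then have "sigma (x 0) (e # W @ y # W) \<in> language_of x"
      by (rule language_sigma)
    \<comment> \<open>Whatever the letter before \<open>W\<close>, its image ends with \<open>y\<close>.\<close>
    moreover have "sublist ((y # sigma y W) @ y # sigma y W) (sigma y (e # W @ y # W))"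
      unfolding sublist_def
      by (intro exI[of _ "if e = y then [] else [e]"] exI[of _ "[]"]) auto
    ultimately show ?thesis
      unfolding std_word_Suc_shift W(1) using y language_sublist by simp
  qed
qed

text \<open>Each rule desubstitutes the word to its analogue of the previous stage, down to \<open>yy\<close>.\<close>

lemma std_word_snoc_notin:
  assumes "ar_rules x" "\<forall>j\<le>k. x j \<noteq> y"
  shows "std_word x y k @ [y] \<notin> language_of x"
  using assms
proof (induction k arbitrary: x)
  case 0
  then show ?case
    using adjacent_letters[of y y x] by auto
next
  case (Suc k)
  let ?r = "x 0"
  have ne: "y \<noteq> ?r"
    using Suc.prems(2) by auto
  obtain W where W: "std_word (shift x) y k = y # W"
    using std_word_Cons by blast
  show ?case
  proof
    assume "std_word x y (Suc k) @ [y] \<in> language_of x"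
    then obtain e where e: "(std_word x y (Suc k) @ [y]) @ [e] \<in> language_of x"
      using extend_right[OF Suc.prems(1)] by blast
    then have "[y, e] \<in> language_of x"
      using language_sublist sublist_append_leftI[of "[y, e]" "std_word x y (Suc k)"]
      by (simp del: std_word.simps)
    then have "e = ?r"
      using adjacent_letters[of y e x] ne by blast
    then have "sigma ?r (y # W @ [y]) \<in> language_of x"
      using e ne unfolding std_word_Suc_shift W by simp
    then have "std_word (shift x) y k @ [y] \<in> language_of (shift x)"
      using desubstitute_hd[OF Suc.prems(1)] ne W by simp
    moreover have "\<forall>j\<le>k. shift x j \<noteq> y"
      using Suc.prems(2) by (auto simp: shift_def)
    ultimately show False
      using Suc.IH[OF ar_rules_shift] Suc.prems(1) by blast
  qed
qed

lemma square_std_word_stage: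
  assumes "ar_rules x" "v \<in> conjugates (std_word x y k)" "v @ v \<in> language_of x"
  shows "first_stage x y \<le> k"
proof (rule ccontr)
  assume early: "\<not> first_stage x y \<le> k"
  then have "\<forall>j\<le>k. x j \<noteq> y"
    using Least_le[of "\<lambda>k. x k = y"] unfolding first_stage_def by fastforce
  then have notin: "std_word x y k @ [y] \<notin> language_of x"
    using std_word_snoc_notin[OF assms(1)] by blast
  obtain p q where pq: "std_word x y k = p @ q" "v = q @ p"
    using assms(2) by (auto simp: conjugates_split)
  obtain W where W: "std_word x y k = y # W"
    using std_word_Cons by blast
  have "sublist (std_word x y k @ [y]) (v @ v)"
  proof (cases p)
    case Nil
    then show ?thesis
      using pq W unfolding sublist_def by (intro exI[of _ "[]"] exI[of _ W]) auto
  next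
    case (Cons y' p')
    then have "y' = y"
      using pq W by simp
    then show ?thesis
      using pq Cons unfolding sublist_def by (intro exI[of _ q] exI[of _ p']) auto
  qed
  then show False
    using notin assms(3) language_sublist by blast
qed

text \<open>
  The three letters play the same part here; the condition on \<open>A\<^sub>p\<close> becomes void when the first rule
  is \<open>(a)\<close>.
\<close>

lemma primitive_squares_in_language:
  assumes "ar_rules x"
  defines "S \<equiv> {std_word x y p | y p. p \<ge> first_stage x y}"
  shows "S \<subseteq> {v. primitive_word v \<and> v @ v \<in> language_of x}"
    and "{v. primitive_word v \<and> v @ v \<in> language_of x} \<subseteq> (\<Union>w\<in>S. conjugates w)"
proof -
  have "x (first_stage x y) = y" for y
    using ar_rules_later[OF assms(1), of 0 y] LeastI[of "\<lambda>k. x k = y"]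
    unfolding first_stage_def by blast
  then show "S \<subseteq> {v. primitive_word v \<and> v @ v \<in> language_of x}"
    using std_word_square[OF assms(1)] primitive_std_word by (auto simp: S_def)
  show "{v. primitive_word v \<and> v @ v \<in> language_of x} \<subseteq> (\<Union>w\<in>S. conjugates w)"
  proof clarify
    fix v assume v: "primitive_word v" "v @ v \<in> language_of x"
    then have "conjugates v \<subseteq> language_of x"
      using conjugate_in_square language_sublist by blast
    then obtain y k where yk: "v \<in> conjugates (std_word x y k)"
      using conjugate_std_wordI assms(1) v(1) by blast
    then have "first_stage x y \<le> k"
      using square_std_word_stage[OF assms(1)] v(2) by blast
    then have "std_word x y k \<in> S"
      unfolding S_def by blast
    then show "v \<in> (\<Union>w\<in>S. conjugates w)"
      using yk by blast
  qed
qed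

section \<open>The equivalent conditions\<close>

text \<open>Three applications of the rule \<open>y\<close> from stage \<open>k\<close> on append \<open>std_word x y k\<close> three times to the other words.\<close>

lemma conjugate_std_word_square_ar:
  assumes "standard_ar_word w" "v \<in> conjugates w"
  shows "ar_word (v @ v)"
proof -
  obtain x y k where x: "ar_rules x" and w: "w = std_word x y k"
    using assms(1) by (auto simp: standard_ar_word_def)
  define x' where "x' j = (if k \<le> j \<and> j < k + 3 then y else x j)" for j
  have x': "ar_rules x'"
  proof (rule ar_rulesI)
    fix z m
    obtain j where "j \<ge> max m (k + 3)" "x j = z"
      using ar_rules_later[OF x] by blast
    then show "\<exists>j\<ge>m. x' j = z"
      by (intro exI[of _ j]) (auto simp: x'_def)
  qed
  obtain u where u: "u \<noteq> y"
    by (metis letter.distinct(1))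
  have same: "std_word x' z k = std_word x z k" for z
    by (rule std_word_cong) (auto simp: x'_def)
  have "std_word x' u (Suc (Suc (Suc k))) = std_word x u k @ w @ w @ w"
    using u by (simp add: x'_def same w)
  then have "sublist (w @ w @ w) (std_word x' u (Suc (Suc (Suc k))))"
    by (simp only: sublist_append_leftI)
  then have "w @ w @ w \<in> language_of x'"
    using std_word_in_language language_sublist by blast
  then have "v @ v \<in> language_of x'"
    using conjugate_square_in_cube[OF assms(2)] language_sublist by blast
  then show ?thesis
    using x' by (auto simp: ar_word_def ar_language_def)
qed

lemma conjugates_in_ar_language:
  assumes "v' \<in> conjugates v" "ar_word (v' @ v')"
  shows "\<exists>L. ar_language L \<and> conjugates v \<subseteq> L"
proof -
  obtain x where x: "ar_rules x" "v' @ v' \<in> language_of x"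
    using assms(2) by (auto simp: ar_word_def ar_language_def)
  have "conjugates v \<subseteq> conjugates v'"
    using assms(1) conjugates_sym conjugates_trans by blast
  then have "conjugates v \<subseteq> language_of x"
    using x(2) conjugate_in_square language_sublist by blast
  then show ?thesis
    using x(1) by (auto simp: ar_language_def)
qed

lemma desubstitutes_letter: "desubstitutes_to_letter [y]"
  unfolding desubstitutes_to_letter_def by (intro exI[of _ "[]"]) auto

lemma desubstitutes_step:
  assumes "desubstitutes_to_letter u" "f \<in> range sigma \<union> range tau"
  shows "desubstitutes_to_letter (f u)"
proof -
  obtain fs y where "set fs \<subseteq> range sigma \<union> range tau" "u = foldr (\<circ>) fs id [y]"
    using assms(1) by (auto simp: desubstitutes_to_letter_def)
  then show ?thesis
    unfolding desubstitutes_to_letter_def using assms(2)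
    by (intro exI[of _ "f # fs"] exI[of _ y]) auto
qed

lemma conjugate_std_word_desubstitutes:
  "v \<in> conjugates (std_word x y k) \<Longrightarrow> desubstitutes_to_letter v"
proof (induction k arbitrary: x v)
  case 0
  then show ?case
    by (auto simp: conjugates_def desubstitutes_letter)
next
  case (Suc k)
  then obtain u' where "u' \<in> conjugates (std_word (shift x) y k)"
      "v = sigma (x 0) u' \<or> v = tau (x 0) u'"
    unfolding std_word_Suc_shift using conjugate_of_sigma by blast
  then show ?case
    using Suc.IH desubstitutes_step by blast
qed

lemma ar_rules_exist: "\<exists>x. ar_rules x"
proof
  let ?x = "\<lambda>n::nat. if n mod 3 = 0 then La else if n mod 3 = 1 then Lb else Lc"
  show "ar_rules ?x"
  proof (rule ar_rulesI)
    fix y and k :: nat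
    have "(3 * k) mod 3 = 0" "(3 * k + 1) mod 3 = 1" "(3 * k + 2) mod 3 = 2"
      by presburger+
    then have "?x (3 * k) = La" "?x (3 * k + 1) = Lb" "?x (3 * k + 2) = Lc"
      by auto
    then show "\<exists>j\<ge>k. ?x j = y"
      by (cases y) (metis le_add1 le_trans mult_le_mono1 one_le_numeral mult_1)+
  qed
qed

lemma desubstitutes_conjugate_std_word:
  assumes "desubstitutes_to_letter v"
  shows "\<exists>w. standard_ar_word w \<and> v \<in> conjugates w"
proof -
  obtain fs y where fs: "set fs \<subseteq> range sigma \<union> range tau" and v: "v = foldr (\<circ>) fs id [y]"
    using assms by (auto simp: desubstitutes_to_letter_def)
  have "\<exists>x k. ar_rules x \<and> foldr (\<circ>) fs id [y] \<in> conjugates (std_word x y k)"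
    using fs
  proof (induction fs)
    case Nil
    obtain x where "ar_rules x"
      using ar_rules_exist by blast
    then show ?case
      using conjugates_refl[of "[y]"] by (intro exI[of _ x] exI[of _ 0]) auto
  next
    case (Cons f fs)
    let ?u = "foldr (\<circ>) fs id [y]"
    have "set fs \<subseteq> range sigma \<union> range tau"
      using Cons.prems by simp
    then obtain x k where x: "ar_rules x" and u: "?u \<in> conjugates (std_word x y k)"
      using Cons.IH by blast
    obtain r where r: "f = sigma r \<or> f = tau r"
      using Cons.prems by auto
    have "f ?u \<in> conjugates (sigma r ?u)"
      using r u conjugates_nonempty conjugates_refl tau_conjugate_sigma by (metis sigma_eq_Nil)
    moreover define x' where "x' = case_nat r x"
    have "shift x' = x" "x' 0 = r"
      by (auto simp: x'_def shift_def)
    then have "std_word x' y (Suc k) = sigma r (std_word x y k)"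
      by (simp only: std_word_Suc_shift)
    ultimately have "f ?u \<in> conjugates (std_word x' y (Suc k))"
      using sigma_conjugates[OF u, of r] conjugates_trans by metis
    moreover have "ar_rules x'"
    proof (rule ar_rulesI)
      fix z m
      obtain j where "j \<ge> m" "x j = z"
        using ar_rules_later[OF x] by blast
      then show "\<exists>j\<ge>m. x' j = z"
        by (intro exI[of _ "Suc j"]) (auto simp: x'_def)
    qed
    ultimately show ?case
      unfolding foldr.simps o_apply by blast
  qed
  then show ?thesis
    unfolding v standard_ar_word_def by blast
qed

lemma ar_square_equivalences:
  fixes v :: word
  assumes "primitive_word v"
  shows "(\<exists>w. standard_ar_word w \<and> v \<in> conjugates w) \<longleftrightarrow> ar_word (v @ v)" (is "?P1 \<longleftrightarrow> ?P2")
    and "ar_word (v @ v) \<longleftrightarrow> (\<exists>v' \<in> conjugates v. ar_word (v' @ v'))" (is "_ \<longleftrightarrow> ?P3")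
    and "(\<exists>v' \<in> conjugates v. ar_word (v' @ v')) \<longleftrightarrow> (\<exists>L. ar_language L \<and> conjugates v \<subseteq> L)"
      (is "_ \<longleftrightarrow> ?P4")
    and "(\<exists>L. ar_language L \<and> conjugates v \<subseteq> L) \<longleftrightarrow> desubstitutes_to_letter v" (is "_ \<longleftrightarrow> ?P5")
proof -
  have "?P1 \<Longrightarrow> ?P2"
    using conjugate_std_word_square_ar by blast
  moreover have "v \<in> conjugates v"
    using assms conjugates_refl by (auto simp: primitive_word_def)
  then have "?P2 \<Longrightarrow> ?P3" by blast
  moreover have "?P3 \<Longrightarrow> ?P4"
    using conjugates_in_ar_language by blast
  moreover have "?P4 \<Longrightarrow> ?P1"
    using conjugate_std_wordI assms unfolding ar_language_def standard_ar_word_def by metis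
  moreover have "?P1 \<Longrightarrow> ?P5"
    using conjugate_std_word_desubstitutes by (auto simp: standard_ar_word_def)
  moreover have "?P5 \<Longrightarrow> ?P1"
    using desubstitutes_conjugate_std_word by blast
  ultimately show "?P1 \<longleftrightarrow> ?P2" "?P2 \<longleftrightarrow> ?P3" "?P3 \<longleftrightarrow> ?P4" "?P4 \<longleftrightarrow> ?P5"
    by argo+
qed

section \<open>Primitive squares in Arnoux-Rauzy languages\<close>

theorem proposition7:
  shows "(\<forall>x. ar_rules x \<and> Rabc x \<longrightarrow>
           (let \<Lambda> = language_of x;
                l1 = first_stage x Lb;
                l2 = first_stage x Lc;
                S = {std_word x La p | p. p \<ge> 0}
                  \<union> {std_word x Lb p | p. p \<ge> l1}
                  \<union> {std_word x Lc p | p. p \<ge> l2}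
            in \<exists>T. T \<subseteq> (\<Union>w\<in>S. conjugates w) \<and>
                   {v. primitive_word v \<and> v @ v \<in> \<Lambda>} = S \<union> T))
       \<and> (\<forall>v :: word. primitive_word v \<longrightarrow>
           ((\<exists>w. standard_ar_word w \<and> v \<in> conjugates w) \<longleftrightarrow> ar_word (v @ v))
         \<and> (ar_word (v @ v) \<longleftrightarrow> (\<exists>v' \<in> conjugates v. ar_word (v' @ v')))
         \<and> ((\<exists>v' \<in> conjugates v. ar_word (v' @ v')) \<longleftrightarrow>
            (\<exists>\<Lambda>. ar_language \<Lambda> \<and> conjugates v \<subseteq> \<Lambda>))
         \<and> ((\<exists>\<Lambda>. ar_language \<Lambda> \<and> conjugates v \<subseteq> \<Lambda>) \<longleftrightarrow>
            desubstitutes_to_letter v))"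
proof (intro conjI allI impI)
  fix x assume x: "ar_rules x \<and> Rabc x"
  let ?Q = "{v. primitive_word v \<and> v @ v \<in> language_of x}"
  let ?S = "{std_word x La p | p. p \<ge> 0}
    \<union> {std_word x Lb p | p. p \<ge> first_stage x Lb} \<union> {std_word x Lc p | p. p \<ge> first_stage x Lc}"
  have "first_stage x La = 0"
    using x by (simp add: first_stage_def Rabc_def)
  moreover have "(\<exists>y. P y) \<longleftrightarrow> P La \<or> P Lb \<or> P Lc" for P :: "letter \<Rightarrow> bool"
    by (metis letter.exhaust)
  ultimately have "w \<in> ?S \<longleftrightarrow> (\<exists>y p. w = std_word x y p \<and> p \<ge> first_stage x y)" for w
    by simp
  then have S: "?S = {std_word x y p | y p. p \<ge> first_stage x y}"
    by (simp only: set_eq_iff mem_Collect_eq simp_thms)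
  have "?S \<subseteq> ?Q" "?Q \<subseteq> (\<Union>w\<in>?S. conjugates w)"
    unfolding S using x by (intro primitive_squares_in_language; blast)+
  then have "\<exists>T. T \<subseteq> (\<Union>w\<in>?S. conjugates w) \<and> ?Q = ?S \<union> T"
    by (intro exI[of _ ?Q]) (simp only: Un_absorb1)
  then show "let \<Lambda> = language_of x;
                l1 = first_stage x Lb;
                l2 = first_stage x Lc;
                S = {std_word x La p | p. p \<ge> 0}
                  \<union> {std_word x Lb p | p. p \<ge> l1}
                  \<union> {std_word x Lc p | p. p \<ge> l2}
            in \<exists>T. T \<subseteq> (\<Union>w\<in>S. conjugates w) \<and>
                   {v. primitive_word v \<and> v @ v \<in> \<Lambda>} = S \<union> T"
    unfolding Let_def .
qed (fact ar_square_equivalences)+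

end
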